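(* Let $z_1,z_2,z_3$ satisfy $|z_i|>1$, $z_i\neq\pm z_j$ for $i\ne j$, put $\mathcal D_i=\mathcal D(z_i)$, and let $F(\mathbf t)$, $\mathbf t=(t_1,t_3,t_5,\dots)$, satisfy the dispersionless BKP addition formula $$1+c_2c_3\,e^{-(\mathcal D_3\mathcal D_1+\mathcal D_1\mathcal D_2)F}+c_1c_3\,e^{-(\mathcal D_2\mathcal D_3+\mathcal D_1\mathcal D_2)F}+c_2c_1\,e^{-(\mathcal D_3\mathcal D_1+\mathcal D_2\mathcal D_3)F}=0,$$ where $c_i=\frac{z_j+z_k}{z_j-z_k}$ for $(i,j,k)$ a cyclic permutation of $(1,2,3)$. Let $\phi(\mathbf t)$ be a conformally invariant symmetry of $F$: for every value of the parameter $\Theta$, $\delta F=e^{\Theta\phi}$ is an infinitesimal symmetry of the addition formula. Write $\phi_i=\mathcal D_i\phi$ and $f^i_{jk}=\mathcal D_i\ln\frac{\phi_j}{\phi_k}$. Then, wherever $\phi_1,\phi_2,\phi_3$ and the arguments of the logarithms below are defined and nonzero, $$\mathcal D_1\ln\frac{(f^1_{23}+f^2_{31}+f^3_{12})(f^1_{32}+f^2_{31}+f^3_{12})}{(f^1_{23}+f^2_{13}+f^3_{12})(f^1_{23}+f^2_{31}+f^3_{21})}=\mathcal D_2\ln\frac{(f^1_{23}+f^2_{31}+f^3_{12})(f^1_{23}+f^2_{13}+f^3_{12})}{(f^1_{23}+f^2_{31}+f^3_{21})(f^1_{32}+f^2_{31}+f^3_{12})}.$$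
   Context: The B-type quasiclassical vertex operator is $\mathcal D(z)=2\sum_{n=0}^\infty\frac{z^{-(2n+1)}}{2n+1}\frac{\partial}{\partial t_{2n+1}}$, $|z|>1$; functions of $\mathbf t$ are smooth, all series obtained by applying vertex operators are assumed to converge, and vertex operators are commuting derivations. An infinitesimal symmetry $\delta F$ of the addition formula is a solution of its linearization at $F$, i.e. $$c_2c_3e^{-(F_{31}+F_{12})}(\delta F_{31}+\delta F_{12})+c_1c_3e^{-(F_{23}+F_{12})}(\delta F_{23}+\delta F_{12})+c_1c_2e^{-(F_{31}+F_{23})}(\delta F_{31}+\delta F_{23})=0,$$ where $F_{ij}=\mathcal D_i\mathcal D_jF$, $\delta F_{ij}=\mathcal D_i\mathcal D_j\delta F$. An expression $\mathcal D_i\ln g$ means $(\mathcal D_ig)/g$. *)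

theory Defs
  imports "HOL-Analysis.Analysis"
begin

text \<open>
  A point \<open>t :: nat \<Rightarrow> real\<close> stands for \<open>(t\<^sub>1, t\<^sub>3, t\<^sub>5, \<dots>)\<close>: the entry \<open>t n\<close> is the time with
  subscript \<open>2n+1\<close>.
\<close>

type_synonym times = "nat \<Rightarrow> real"
type_synonym tfun = "times \<Rightarrow> complex"

definition partial_deriv :: "nat \<Rightarrow> tfun \<Rightarrow> tfun" where
  "partial_deriv n g t = vector_derivative (\<lambda>x. g (t(n := x))) (at (t n))"

text \<open>
  Domains and smoothness refer to finite-dimensional coordinate slices only, so that no
  topology on the space of infinitely many times has to be chosen. The map
  \<open>s \<mapsto> override_on t s I\<close> depends only on the finitely many coordinates of \<open>s\<close> in \<open>I\<close>, hence on these
  slices the product topology used below is the Euclidean one.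
\<close>

definition finitely_open :: "times set \<Rightarrow> bool" where
  "finitely_open U \<longleftrightarrow> (\<forall>t I. finite I \<longrightarrow> open {s. override_on t s I \<in> U})"

definition smooth_times_on :: "times set \<Rightarrow> tfun \<Rightarrow> bool" where
  "smooth_times_on U g \<longleftrightarrow> (\<forall>ns. \<forall>t\<in>U. let h = foldr partial_deriv ns g in
      (\<forall>n. (\<lambda>x. h (t(n := x))) differentiable (at (t n))) \<and>
      (\<forall>I. finite I \<longrightarrow> isCont (\<lambda>s. h (override_on t s I)) t))"

definition vertex_term :: "complex \<Rightarrow> tfun \<Rightarrow> times \<Rightarrow> nat \<Rightarrow> complex" where
  "vertex_term z g t n = inverse z ^ (2 * n + 1) / of_nat (2 * n + 1) * partial_deriv n g t"

definition vertex_op :: "complex \<Rightarrow> tfun \<Rightarrow> tfun" where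
  "vertex_op z g t = 2 * (\<Sum>n. vertex_term z g t n)"

text \<open>The functions obtained from \<open>g\<close> by applying finitely many vertex operators.\<close>

inductive_set vertex_orbit :: "tfun \<Rightarrow> tfun set" for g :: tfun where
  base: "g \<in> vertex_orbit g"
| step: "h \<in> vertex_orbit g \<Longrightarrow> norm z > 1 \<Longrightarrow> vertex_op z h \<in> vertex_orbit g"

text \<open>
  The standing assumptions on the functions of the times: smoothness, convergence of all series
  arising from vertex operators, and commutativity of the vertex operators. The Leibniz rule is
  not listed because it follows from convergence.
\<close>

definition admissible_on :: "times set \<Rightarrow> tfun \<Rightarrow> bool" where
  "admissible_on U g \<longleftrightarrow> (\<forall>h \<in> vertex_orbit g.
      smooth_times_on U h \<and>
      (\<forall>z. norm z > 1 \<longrightarrow> (\<forall>t\<in>U. summable (vertex_term z h t))) \<and>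
      (\<forall>z w. norm z > 1 \<longrightarrow> norm w > 1 \<longrightarrow>
        (\<forall>t\<in>U. vertex_op z (vertex_op w h) t = vertex_op w (vertex_op z h) t)))"

text \<open>\<open>\<D>(z) ln g\<close>, without any choice of a branch of the logarithm.\<close>

definition vertex_dln :: "complex \<Rightarrow> tfun \<Rightarrow> tfun" where
  "vertex_dln z g t = vertex_op z g t / g t"

definition cfac :: "complex \<Rightarrow> complex \<Rightarrow> complex" where
  "cfac zj zk = (zj + zk) / (zj - zk)"

definition BKP_addition ::
  "times set \<Rightarrow> complex \<Rightarrow> complex \<Rightarrow> complex \<Rightarrow> tfun \<Rightarrow> bool" where
  "BKP_addition U z1 z2 z3 F \<longleftrightarrow> (\<forall>t\<in>U.
    let c1 = cfac z2 z3; c2 = cfac z3 z1; c3 = cfac z1 z2;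
        F12 = vertex_op z1 (vertex_op z2 F) t;
        F23 = vertex_op z2 (vertex_op z3 F) t;
        F31 = vertex_op z3 (vertex_op z1 F) t
    in 1 + c2 * c3 * exp (- (F31 + F12)) + c1 * c3 * exp (- (F23 + F12))
         + c2 * c1 * exp (- (F31 + F23)) = 0)"

definition infinitesimal_symmetry ::
  "times set \<Rightarrow> complex \<Rightarrow> complex \<Rightarrow> complex \<Rightarrow> tfun \<Rightarrow> tfun \<Rightarrow> bool" where
  "infinitesimal_symmetry U z1 z2 z3 F dF \<longleftrightarrow> (\<forall>t\<in>U.
    let c1 = cfac z2 z3; c2 = cfac z3 z1; c3 = cfac z1 z2;
        F12 = vertex_op z1 (vertex_op z2 F) t;
        F23 = vertex_op z2 (vertex_op z3 F) t;
        F31 = vertex_op z3 (vertex_op z1 F) t;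
        dF12 = vertex_op z1 (vertex_op z2 dF) t;
        dF23 = vertex_op z2 (vertex_op z3 dF) t;
        dF31 = vertex_op z3 (vertex_op z1 dF) t
    in c2 * c3 * exp (- (F31 + F12)) * (dF31 + dF12)
     + c1 * c3 * exp (- (F23 + F12)) * (dF23 + dF12)
     + c1 * c2 * exp (- (F31 + F23)) * (dF31 + dF23) = 0)"

definition conformally_invariant_symmetry ::
  "times set \<Rightarrow> complex \<Rightarrow> complex \<Rightarrow> complex \<Rightarrow> tfun \<Rightarrow> tfun \<Rightarrow> bool" where
  "conformally_invariant_symmetry U z1 z2 z3 F \<phi> \<longleftrightarrow>
    (\<forall>\<Theta>::complex. infinitesimal_symmetry U z1 z2 z3 F (\<lambda>t. exp (\<Theta> * \<phi> t)))"

text \<open>\<open>fratio zi zj zk \<phi>\<close> is \<open>f\<^sup>i\<^sub>j\<^sub>k = \<D>\<^sub>i ln (\<phi>\<^sub>j / \<phi>\<^sub>k)\<close>.\<close>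

definition fratio :: "complex \<Rightarrow> complex \<Rightarrow> complex \<Rightarrow> tfun \<Rightarrow> tfun" where
  "fratio zi zj zk \<phi> = vertex_dln zi (\<lambda>t. vertex_op zj \<phi> t / vertex_op zk \<phi> t)"

end

(* Write A, B, C for the three exponential terms of the addition formula, so 1 + A + B + C = 0.
   Comparing the coefficients of \<Theta> and \<Theta>\<^sup>2 in the linearization at exp (\<Theta> \<phi>) gives two linear equations
   for (A, B, C). Their solution is A = -Q/P, B = -R/P, C = -S/P, because Q, R, S are, up to a
   common sign, the components of the cross product of the two coefficient vectors, and
   P = Q + R + S. Hence PQ/(RS) = -A/(BC) = - exp (2 F23) / c1^2 and
   PR/(SQ) = -B/(CA) = - exp (2 F31) / c2^2, so that both sides of the claim equal 2 F123. *)
theory Submission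
  imports Defs
begin

section \<open>Calculus of vertex derivatives along coordinate lines\<close>

text \<open>\<open>vertex_op\<close> is total: where a partial derivative or the series fails to
  exist, its value is unspecified and obeys no calculus rule. This relation carries the
  coordinatewise derivatives and the convergence along with the value, so that sums, products and
  compositions can be treated term by term.\<close>

definition has_vertex_derivative :: "complex \<Rightarrow> tfun \<Rightarrow> complex \<Rightarrow> times \<Rightarrow> bool" where
  "has_vertex_derivative z g D t \<longleftrightarrow>
     (\<exists>p. (\<forall>n. ((\<lambda>x. g (t(n := x))) has_vector_derivative p n) (at (t n))) \<and>
          (\<lambda>n. 2 * (inverse z ^ (2 * n + 1) / of_nat (2 * n + 1) * p n)) sums D)"

text \<open>A substitute for a neighbourhood in infinitely many variables. A vertex operator sees
  its argument only through the partial derivatives at \<open>t\<close>, so it suffices to control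
  each line through \<open>t\<close> parallel to an axis; the size of the interval may depend on
  \<open>n\<close>. The filter \<open>nhds\<close> includes the point \<open>t\<close>
  itself.\<close>

definition coord_near :: "times \<Rightarrow> (times \<Rightarrow> bool) \<Rightarrow> bool" where
  "coord_near t A \<longleftrightarrow> (\<forall>n. eventually (\<lambda>x. A (t(n := x))) (nhds (t n)))"

lemma coord_near_conj:
  "coord_near t A \<Longrightarrow> coord_near t B \<Longrightarrow> coord_near t (\<lambda>s. A s \<and> B s)"
  by (simp add: coord_near_def eventually_conj)

lemma coord_near_mono:
  assumes "coord_near t A" "\<And>s. A s \<Longrightarrow> B s"
  shows "coord_near t B"
  unfolding coord_near_def
  by (intro allI, rule eventually_mono[OF assms(1)[unfolded coord_near_def, rule_format]])
    (rule assms(2))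

lemma coord_near_at:
  assumes "coord_near t A" shows "A t"
  using assms eventually_nhds_x_imp_x[of "\<lambda>x. A (t(0 := x))" "t 0"]
  by (simp add: coord_near_def)

text \<open>Slices with the single free coordinate \<open>n\<close> are enough: their open sets are
  pulled back along the continuous line \<open>x\<close> to \<open>t(n := x)\<close>.\<close>

lemma finitely_open_coord_near:
  assumes U: "finitely_open U" and t: "t \<in> U"
  shows "coord_near t (\<lambda>s. s \<in> U)"
  unfolding coord_near_def
proof
  fix n
  have "open {s. override_on t s {n} \<in> U}"
    using U by (simp add: finitely_open_def)
  moreover have "continuous_on UNIV (\<lambda>x. t(n := x))"
  proof (rule continuous_on_coordinatewise_then_product)
    show "continuous_on UNIV (\<lambda>x. (t(n := x)) i)" for i
      by (cases "i = n") auto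
  qed
  ultimately have "open ((\<lambda>x. t(n := x)) -` {s. override_on t s {n} \<in> U})"
    using open_vimage by blast
  moreover have "override_on t (t(n := x)) {n} = t(n := x)" for x
    by (auto simp: override_on_def)
  ultimately have "open {x. t(n := x) \<in> U}"
    by (simp add: vimage_def)
  then show "\<forall>\<^sub>F x in nhds (t n). t(n := x) \<in> U"
    using t by (auto simp: eventually_nhds)
qed

lemma has_vertex_derivative_imp_vertex_op:
  assumes "has_vertex_derivative z g D t"
  shows "vertex_op z g t = D"
proof -
  obtain p where p: "\<And>n. ((\<lambda>x. g (t(n := x))) has_vector_derivative p n) (at (t n))"
    and s: "(\<lambda>n. 2 * (inverse z ^ (2 * n + 1) / of_nat (2 * n + 1) * p n)) sums D"
    using assms unfolding has_vertex_derivative_def by blast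
  have "vertex_term z g t = (\<lambda>n. inverse z ^ (2 * n + 1) / of_nat (2 * n + 1) * p n)"
    by (simp add: fun_eq_iff vertex_term_def partial_deriv_def vector_derivative_at[OF p])
  with s have "(\<lambda>n. 2 * vertex_term z g t n) sums D" by simp
  then have "(\<lambda>n. vertex_term z g t n) sums (D / 2)"
    using sums_divide[of "\<lambda>n. 2 * vertex_term z g t n" D 2] by simp
  then have "(\<Sum>n. vertex_term z g t n) = D / 2"
    by (rule sums_unique[symmetric])
  then show ?thesis
    by (simp only: vertex_op_def) simp
qed

lemma has_vertex_derivative_vertex_op:
  assumes "\<And>n. (\<lambda>x. g (t(n := x))) differentiable (at (t n))"
    and "summable (vertex_term z g t)"
  shows "has_vertex_derivative z g (vertex_op z g t) t"
  unfolding has_vertex_derivative_def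
proof (intro exI[of _ "\<lambda>n. partial_deriv n g t"] conjI allI)
  show "((\<lambda>x. g (t(n := x))) has_vector_derivative partial_deriv n g t) (at (t n))" for n
    using assms(1) by (simp add: partial_deriv_def vector_derivative_works[symmetric])
  show "(\<lambda>n. 2 * (inverse z ^ (2 * n + 1) / of_nat (2 * n + 1) * partial_deriv n g t))
      sums vertex_op z g t"
    using sums_mult[OF summable_sums[OF assms(2)], of 2]
    unfolding vertex_op_def vertex_term_def .
qed

text \<open>Each partial derivative depends only on the germ along its own line, and the series is
  left unchanged. This locality permits replacing a function by a closed form valid only near
  \<open>t\<close>.\<close>

lemma has_vertex_derivative_coord_near:
  assumes "has_vertex_derivative z g D t" "coord_near t (\<lambda>s. g s = h s)"
  shows "has_vertex_derivative z h D t"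
proof -
  obtain p where p: "\<And>n. ((\<lambda>x. g (t(n := x))) has_vector_derivative p n) (at (t n))"
    and s: "(\<lambda>n. 2 * (inverse z ^ (2 * n + 1) / of_nat (2 * n + 1) * p n)) sums D"
    using assms(1) unfolding has_vertex_derivative_def by blast
  have "((\<lambda>x. h (t(n := x))) has_vector_derivative p n) (at (t n))" for n
  proof (subst has_vector_derivative_cong_ev[where g = "\<lambda>x. g (t(n := x))"])
    show "\<forall>\<^sub>F x in nhds (t n). x \<in> UNIV \<longrightarrow> h (t(n := x)) = g (t(n := x))"
      using assms(2) unfolding coord_near_def by (simp add: eq_commute)
    show "h (t(n := t n)) = g (t(n := t n))"
      using coord_near_at[OF assms(2)] by simp
  qed (rule p)
  with s show ?thesis unfolding has_vertex_derivative_def by blast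
qed

text \<open>The values \<open>h t\<close> and \<open>g t\<close> do not depend on the summation
  index, so the product rule in each coordinate turns the series into a linear combination of two
  convergent ones.\<close>

lemma has_vertex_derivative_mult:
  assumes "has_vertex_derivative z g D t" "has_vertex_derivative z h E t"
  shows "has_vertex_derivative z (\<lambda>s. g s * h s) (D * h t + g t * E) t"
proof -
  obtain p where p: "\<And>n. ((\<lambda>x. g (t(n := x))) has_vector_derivative p n) (at (t n))"
    and s: "(\<lambda>n. 2 * (inverse z ^ (2 * n + 1) / of_nat (2 * n + 1) * p n)) sums D"
    using assms(1) unfolding has_vertex_derivative_def by blast
  obtain q where q: "\<And>n. ((\<lambda>x. h (t(n := x))) has_vector_derivative q n) (at (t n))"
    and r: "(\<lambda>n. 2 * (inverse z ^ (2 * n + 1) / of_nat (2 * n + 1) * q n)) sums E"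
    using assms(2) unfolding has_vertex_derivative_def by blast
  have "((\<lambda>x. g (t(n := x)) * h (t(n := x))) has_vector_derivative (p n * h t + g t * q n)) (at (t n))" for n
    using has_vector_derivative_mult[OF p[of n] q[of n]] by (simp add: add.commute)
  moreover have "(\<lambda>n. 2 * (inverse z ^ (2 * n + 1) / of_nat (2 * n + 1) * (p n * h t + g t * q n)))
      sums (D * h t + g t * E)"
    using sums_add[OF sums_mult2[OF s, of "h t"] sums_mult[OF r, of "g t"]]
    by (simp add: algebra_simps add_divide_distrib)
  ultimately show ?thesis unfolding has_vertex_derivative_def
    by (intro exI[of _ "\<lambda>n. p n * h t + g t * q n"]) auto
qed

text \<open>The outer derivative is one constant \<open>f'\<close> common to all coordinates;
  convergence is inherited from the inner series.\<close>

lemma has_vertex_derivative_chain: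
  assumes "has_vertex_derivative z g D t" "(f has_field_derivative f') (at (g t))"
  shows "has_vertex_derivative z (\<lambda>s. f (g s)) (f' * D) t"
proof -
  obtain p where p: "\<And>n. ((\<lambda>x. g (t(n := x))) has_vector_derivative p n) (at (t n))"
    and s: "(\<lambda>n. 2 * (inverse z ^ (2 * n + 1) / of_nat (2 * n + 1) * p n)) sums D"
    using assms(1) unfolding has_vertex_derivative_def by blast
  have "((\<lambda>x. f (g (t(n := x)))) has_vector_derivative (f' * p n)) (at (t n))" for n
    using field_vector_diff_chain_at[OF p[of n], of f f'] assms(2) by (simp add: o_def mult.commute)
  moreover have "(\<lambda>n. 2 * (inverse z ^ (2 * n + 1) / of_nat (2 * n + 1) * (f' * p n))) sums (f' * D)"
    using sums_mult[OF s, of f'] by (simp add: algebra_simps)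
  ultimately show ?thesis unfolding has_vertex_derivative_def
    by (intro exI[of _ "\<lambda>n. f' * p n"]) auto
qed

lemma has_vertex_derivative_divide:
  assumes g: "has_vertex_derivative z g D t" and h: "has_vertex_derivative z h E t"
    and nz: "h t \<noteq> 0"
  shows "has_vertex_derivative z (\<lambda>s. g s / h s) ((D * h t - g t * E) / (h t)\<^sup>2) t"
proof -
  have "((\<lambda>x. inverse x) has_field_derivative - (inverse (h t) ^ 2)) (at (h t))"
    using DERIV_inverse[OF nz] by (simp add: numeral_2_eq_2)
  from has_vertex_derivative_mult[OF g has_vertex_derivative_chain[OF h this]] nz
  show ?thesis
    by (simp add: field_simps power2_eq_square)
qed

lemma vertex_dln_divide:
  assumes "has_vertex_derivative z g D t" "has_vertex_derivative z h E t"
    and "g t \<noteq> 0" "h t \<noteq> 0"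
  shows "vertex_dln z (\<lambda>s. g s / h s) t = D / g t - E / h t"
  using has_vertex_derivative_imp_vertex_op[OF has_vertex_derivative_divide[OF assms(1,2,4)]] assms(3,4)
  by (simp add: vertex_dln_def field_simps power2_eq_square)

section \<open>Admissible functions, locality and continuity\<close>

lemma admissible_on_has_vertex_derivative:
  assumes "admissible_on U g" "h \<in> vertex_orbit g" "norm z > 1" "t \<in> U"
  shows "has_vertex_derivative z h (vertex_op z h t) t"
proof (rule has_vertex_derivative_vertex_op)
  have "smooth_times_on U h"
    using assms by (simp add: admissible_on_def)
  \<comment> \<open>The empty list of partial derivatives in \<open>smooth_times_on\<close> yields
    \<open>h\<close> itself.\<close>
  then show "(\<lambda>x. h (t(n := x))) differentiable (at (t n))" for n
    using assms(4) unfolding smooth_times_on_def Let_def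
    by (metis foldr.simps(1) id_apply)
  show "summable (vertex_term z h t)"
    using assms by (simp add: admissible_on_def)
qed

lemma admissible_on_vertex_op_commute:
  assumes "admissible_on U g" "h \<in> vertex_orbit g" "norm z > 1" "norm w > 1" "t \<in> U"
  shows "vertex_op z (vertex_op w h) t = vertex_op w (vertex_op z h) t"
  using assms by (simp add: admissible_on_def)

lemma vertex_op_cong_coord_near:
  assumes "has_vertex_derivative z g D t" "coord_near t (\<lambda>s. g s = h s)"
  shows "vertex_op z h t = vertex_op z g t"
  using assms has_vertex_derivative_coord_near has_vertex_derivative_imp_vertex_op by metis

text \<open>Differentiability in each coordinate gives continuity along each axis, which is what
  keeps a nonzero value nonzero in the sense of \<open>coord_near\<close>.\<close>

lemma has_vertex_derivative_tendsto:
  assumes "has_vertex_derivative z g D t"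
  shows "((\<lambda>x. g (t(n := x))) \<longlongrightarrow> g t) (nhds (t n))"
proof -
  obtain p where "((\<lambda>x. g (t(n := x))) has_vector_derivative p) (at (t n))"
    using assms unfolding has_vertex_derivative_def by blast
  then have "isCont (\<lambda>x. g (t(n := x))) (t n)"
    by (rule has_vector_derivative_continuous)
  then show ?thesis
    using tendsto_at_iff_tendsto_nhds[of "\<lambda>x. g (t(n := x))" "t n"] by (simp add: isCont_def)
qed

text \<open>The logarithmic derivative cancels the constant \<open>k\<close> and the exponential. A
  closed form of this type is what both sides of the final identity reduce to.\<close>

lemma vertex_dln_exp:
  assumes g: "has_vertex_derivative z g D t"
    and h: "coord_near t (\<lambda>s. h s = k * exp (m * g s))" and k: "k \<noteq> 0"
  shows "vertex_dln z h t = m * D"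
proof -
  have "((\<lambda>w. k * exp (m * w)) has_field_derivative k * (exp (m * g t) * m)) (at (g t))"
    by (auto intro!: derivative_eq_intros)
  from has_vertex_derivative_chain[OF g this]
  have "has_vertex_derivative z h (k * (exp (m * g t) * m) * D) t"
    by (rule has_vertex_derivative_coord_near) (rule coord_near_mono[OF h], simp)
  then show ?thesis
    using k by (simp add: vertex_dln_def has_vertex_derivative_imp_vertex_op coord_near_at[OF h])
qed

section \<open>The linearized equation at an exponential symmetry\<close>

lemma vertex_op_vertex_op_exp:
  assumes U: "finitely_open U" and \<phi>: "admissible_on U \<phi>" and t: "t \<in> U"
    and z: "norm z > 1" and w: "norm w > 1"
  shows "vertex_op z (vertex_op w (\<lambda>s. exp (\<Theta> * \<phi> s))) t =
    exp (\<Theta> * \<phi> t) * (\<Theta> * vertex_op z (vertex_op w \<phi>) t +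
      \<Theta>\<^sup>2 * (vertex_op z \<phi> t * vertex_op w \<phi> t))"
proof -
  have d: "has_vertex_derivative v (\<lambda>s. exp (\<Theta> * \<phi> s)) (\<Theta> * exp (\<Theta> * \<phi> s) * vertex_op v \<phi> s) s"
    if "s \<in> U" "norm v > 1" for s v
    by (rule has_vertex_derivative_chain[where f = "\<lambda>y. exp (\<Theta> * y)" and g = \<phi>])
      (auto intro!: derivative_eq_intros admissible_on_has_vertex_derivative[OF \<phi>]
        vertex_orbit.base that)
  have \<Theta>: "((\<lambda>y. \<Theta> * y) has_field_derivative \<Theta>) (at (exp (\<Theta> * \<phi> t)))"
    by (auto intro!: derivative_eq_intros)
  have "has_vertex_derivative z (\<lambda>s. \<Theta> * exp (\<Theta> * \<phi> s) * vertex_op w \<phi> s)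
    (\<Theta> * (\<Theta> * exp (\<Theta> * \<phi> t) * vertex_op z \<phi> t) * vertex_op w \<phi> t
      + \<Theta> * exp (\<Theta> * \<phi> t) * vertex_op z (vertex_op w \<phi>) t) t"
    by (intro has_vertex_derivative_mult has_vertex_derivative_chain[OF d[OF t z] \<Theta>]
        admissible_on_has_vertex_derivative[OF \<phi>] vertex_orbit.intros w z t)
  \<comment> \<open>The formula for the inner operator holds throughout \<open>U\<close>, hence near
    \<open>t\<close>, so by locality the outer operator may be applied to it.\<close>
  moreover have "coord_near t (\<lambda>s. \<Theta> * exp (\<Theta> * \<phi> s) * vertex_op w \<phi> s = vertex_op w (\<lambda>s. exp (\<Theta> * \<phi> s)) s)"
    by (rule coord_near_mono[OF finitely_open_coord_near[OF U t]])
      (simp add: has_vertex_derivative_imp_vertex_op[OF d] w)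
  ultimately show ?thesis
    by (simp add: has_vertex_derivative_imp_vertex_op[OF has_vertex_derivative_coord_near]
        algebra_simps power2_eq_square)
qed

lemma fratio_eq:
  assumes "admissible_on U \<phi>" "s \<in> U" "norm zi > 1" "norm zj > 1" "norm zk > 1"
    and "vertex_op zj \<phi> s \<noteq> 0" "vertex_op zk \<phi> s \<noteq> 0"
  shows "fratio zi zj zk \<phi> s = vertex_op zi (vertex_op zj \<phi>) s / vertex_op zj \<phi> s
    - vertex_op zi (vertex_op zk \<phi>) s / vertex_op zk \<phi> s"
  unfolding fratio_def
  by (intro vertex_dln_divide admissible_on_has_vertex_derivative[OF assms(1)]
      vertex_orbit.intros assms)

text \<open>After the nonzero factor \<open>exp (\<Theta> * \<phi> t)\<close> is cancelled, the
  linearization is a quadratic polynomial in \<open>\<Theta>\<close> without constant term. Since it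
  vanishes for all \<open>\<Theta>\<close>, both of its coefficients are zero.\<close>

lemma conformally_invariant_symmetry_coefficients:
  assumes U: "finitely_open U" and \<phi>: "admissible_on U \<phi>"
    and symmetry: "conformally_invariant_symmetry U z1 z2 z3 F \<phi>" and t: "t \<in> U"
    and z: "norm z1 > 1" "norm z2 > 1" "norm z3 > 1"
  defines "F12 \<equiv> vertex_op z1 (vertex_op z2 F) t"
    and "F23 \<equiv> vertex_op z2 (vertex_op z3 F) t"
    and "F31 \<equiv> vertex_op z3 (vertex_op z1 F) t"
  defines "A \<equiv> cfac z3 z1 * cfac z1 z2 * exp (- (F31 + F12))"
    and "B \<equiv> cfac z2 z3 * cfac z1 z2 * exp (- (F23 + F12))"
    and "C \<equiv> cfac z2 z3 * cfac z3 z1 * exp (- (F31 + F23))"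
  defines "x \<equiv> vertex_op z2 (vertex_op z3 \<phi>) t"
    and "y \<equiv> vertex_op z3 (vertex_op z1 \<phi>) t"
    and "w \<equiv> vertex_op z1 (vertex_op z2 \<phi>) t"
    and "p1 \<equiv> vertex_op z1 \<phi> t" and "p2 \<equiv> vertex_op z2 \<phi> t" and "p3 \<equiv> vertex_op z3 \<phi> t"
  shows "A * (y + w) + B * (x + w) + C * (x + y) = 0"
    and "A * (p1 * (p2 + p3)) + B * (p2 * (p3 + p1)) + C * (p3 * (p1 + p2)) = 0"
proof -
  define L where "L = A * (y + w) + B * (x + w) + C * (x + y)"
  define M where "M = A * (p1 * (p2 + p3)) + B * (p2 * (p3 + p1)) + C * (p3 * (p1 + p2))"
  have "\<Theta> * L + \<Theta>\<^sup>2 * M = 0" for \<Theta>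
  proof -
    have "infinitesimal_symmetry U z1 z2 z3 F (\<lambda>t. exp (\<Theta> * \<phi> t))"
      using symmetry by (simp add: conformally_invariant_symmetry_def)
    from this[unfolded infinitesimal_symmetry_def Let_def, rule_format, OF t,
        unfolded vertex_op_vertex_op_exp[OF U \<phi> t z(1) z(2)] vertex_op_vertex_op_exp[OF U \<phi> t z(2) z(3)]
          vertex_op_vertex_op_exp[OF U \<phi> t z(3) z(1)],
        folded F12_def F23_def F31_def x_def y_def w_def p1_def p2_def p3_def,
        folded A_def B_def C_def]
    have "exp (\<Theta> * \<phi> t) * (\<Theta> * L + \<Theta>\<^sup>2 * M) = 0"
      unfolding L_def M_def by algebra
    then show ?thesis by simp
  qed
  \<comment> \<open>The values 1 and -1 separate the odd part \<open>L\<close> from the even part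
    \<open>M\<close>.\<close>
  from this[of 1] this[of "-1"] have "L + M = 0" "- L + M = 0" by simp_all
  then have "L = 0" "M = 0" by algebra+
  then show "A * (y + w) + B * (x + w) + C * (x + y) = 0"
    and "A * (p1 * (p2 + p3)) + B * (p2 * (p3 + p1)) + C * (p3 * (p1 + p2)) = 0"
    by (simp_all add: L_def M_def)
qed

section \<open>Solving the linear system for the exponential terms\<close>

text \<open>By \<open>E2\<close> and \<open>E3\<close>, \<open>(A, B, C)\<close> is orthogonal to
  \<open>(y + w, x + w, x + y)\<close> and \<open>(a2 + a3, a3 + a1, a1 + a2)\<close>. The left
  sides are minus the components of the cross product of these vectors and add up to
  \<open>P\<close>; \<open>E1\<close> fixes the scale. Written without division, the identities also
  cover dependent vectors.\<close>

lemma cross_product_solution: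
  fixes A B C x y w a1 a2 a3 :: "'a::field"
  assumes E1: "1 + A + B + C = 0"
    and E2: "A * (y + w) + B * (x + w) + C * (x + y) = 0"
    and E3: "A * (a2 + a3) + B * (a3 + a1) + C * (a1 + a2) = 0"
  defines "P \<equiv> w * (a2 - a1) + x * (a3 - a2) + y * (a1 - a3)"
  shows "- w * (a1 + a2) + y * (a1 + a3) + x * (a3 - a2) = - A * P"
    and "w * (a1 + a2) + y * (a1 - a3) - x * (a2 + a3) = - B * P"
    and "w * (a2 - a1) - y * (a1 + a3) + x * (a2 + a3) = - C * P"
proof -
  have C: "C = - 1 - A - B" using E1 by algebra
  note E = E2[unfolded C] E3[unfolded C]
  show "- w * (a1 + a2) + y * (a1 + a3) + x * (a3 - a2) = - A * P"
    and "w * (a1 + a2) + y * (a1 - a3) - x * (a2 + a3) = - B * P"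
    and "w * (a2 - a1) - y * (a1 + a3) + x * (a2 + a3) = - C * P"
    using E unfolding P_def C by algebra+
qed

section \<open>The logarithmic identity for the symmetry\<close>

theorem mainTheorem7:
  fixes U :: "times set" and F \<phi> :: tfun and z1 z2 z3 :: complex and t :: times
    and f :: "complex \<Rightarrow> complex \<Rightarrow> complex \<Rightarrow> tfun" and P Q R S :: tfun
  assumes z_norm: "norm z1 > 1" "norm z2 > 1" "norm z3 > 1"
    and z12: "z1 \<noteq> z2" "z1 \<noteq> - z2"
    and z23: "z2 \<noteq> z3" "z2 \<noteq> - z3"
    and z31: "z3 \<noteq> z1" "z3 \<noteq> - z1"
    and U: "finitely_open U"
    and F: "admissible_on U F"
    and addition: "BKP_addition U z1 z2 z3 F"
    and \<phi>: "admissible_on U \<phi>"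
    and symmetry: "conformally_invariant_symmetry U z1 z2 z3 F \<phi>"
    and t: "t \<in> U"
    and \<phi>_nz: "vertex_op z1 \<phi> t \<noteq> 0" "vertex_op z2 \<phi> t \<noteq> 0" "vertex_op z3 \<phi> t \<noteq> 0"
  defines "f \<equiv> (\<lambda>zi zj zk. fratio zi zj zk \<phi>)"
  defines "P \<equiv> (\<lambda>s. f z1 z2 z3 s + f z2 z3 z1 s + f z3 z1 z2 s)"
    and "Q \<equiv> (\<lambda>s. f z1 z3 z2 s + f z2 z3 z1 s + f z3 z1 z2 s)"
    and "R \<equiv> (\<lambda>s. f z1 z2 z3 s + f z2 z1 z3 s + f z3 z1 z2 s)"
    and "S \<equiv> (\<lambda>s. f z1 z2 z3 s + f z2 z3 z1 s + f z3 z2 z1 s)"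
  assumes args_nz: "P t \<noteq> 0" "Q t \<noteq> 0" "R t \<noteq> 0" "S t \<noteq> 0"
  shows "vertex_dln z1 (\<lambda>s. (P s * Q s) / (R s * S s)) t
       = vertex_dln z2 (\<lambda>s. (P s * R s) / (S s * Q s)) t"
proof -
  define F12 where "F12 = vertex_op z1 (vertex_op z2 F)"
  define F23 where "F23 = vertex_op z2 (vertex_op z3 F)"
  define F31 where "F31 = vertex_op z3 (vertex_op z1 F)"
  define c1 c2 c3 where c: "c1 = cfac z2 z3" "c2 = cfac z3 z1" "c3 = cfac z1 z2"
  \<comment> \<open>Distinct parameters keep the denominators nonzero, and
    \<open>zi \<noteq> - zj\<close> does the same for the numerators.\<close>
  have c_nz: "c1 \<noteq> 0" "c2 \<noteq> 0" "c3 \<noteq> 0"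
    using z12 z23 z31 by (auto simp: c cfac_def add_eq_0_iff2)
  define x where "x = vertex_op z2 (vertex_op z3 \<phi>)"
  define y where "y = vertex_op z3 (vertex_op z1 \<phi>)"
  define w where "w = vertex_op z1 (vertex_op z2 \<phi>)"
  define p1 p2 p3 where p: "p1 = vertex_op z1 \<phi>" "p2 = vertex_op z2 \<phi>" "p3 = vertex_op z3 \<phi>"
  define A where "A s = c2 * c3 * exp (- (F31 s + F12 s))" for s
  define B where "B s = c1 * c3 * exp (- (F23 s + F12 s))" for s
  define C where "C s = c1 * c2 * exp (- (F31 s + F23 s))" for s
  \<comment> \<open>The form of \<open>P\<close> in which equal mixed derivatives are identified; it
    is the \<open>P\<close> of \<open>cross_product_solution\<close> for
    \<open>a1 = 1 / p1 s\<close> and so on.\<close>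
  define P' where "P' s = w s * (1 / p2 s - 1 / p1 s) + x s * (1 / p3 s - 1 / p2 s)
    + y s * (1 / p1 s - 1 / p3 s)" for s
  \<comment> \<open>The points where every \<open>fratio\<close> splits into two quotients. The
    relations are proved at all of them, not only at \<open>t\<close>, because they get
    differentiated once more.\<close>
  let ?good = "\<lambda>s. s \<in> U \<and> p1 s \<noteq> 0 \<and> p2 s \<noteq> 0 \<and> p3 s \<noteq> 0"

  have PQRS: "P s = P' s" "Q s = - A s * P' s" "R s = - B s * P' s" "S s = - C s * P' s"
    if "?good s" for s
  proof -
    note \<phi>\<phi> = admissible_on_vertex_op_commute[OF \<phi> vertex_orbit.base]
    have sym: "vertex_op z3 (vertex_op z2 \<phi>) s = x s" "vertex_op z1 (vertex_op z3 \<phi>) s = y s"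
      "vertex_op z2 (vertex_op z1 \<phi>) s = w s" "vertex_op z2 (vertex_op z3 \<phi>) s = x s"
      "vertex_op z3 (vertex_op z1 \<phi>) s = y s" "vertex_op z1 (vertex_op z2 \<phi>) s = w s"
      using z_norm that by (auto simp: x_def y_def w_def intro: \<phi>\<phi>)
    have f: "f z1 z2 z3 s = w s / p2 s - y s / p3 s" "f z1 z3 z2 s = y s / p3 s - w s / p2 s"
      "f z2 z3 z1 s = x s / p3 s - w s / p1 s" "f z2 z1 z3 s = w s / p1 s - x s / p3 s"
      "f z3 z1 z2 s = y s / p1 s - x s / p2 s" "f z3 z2 z1 s = x s / p2 s - y s / p1 s"
      using that z_norm by (simp_all add: f_def fratio_eq[OF \<phi>] p sym)
    note coeffs = conformally_invariant_symmetry_coefficients[OF U \<phi> symmetry conjunct1[OF that] z_norm,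
        folded F12_def F23_def F31_def x_def y_def w_def p c, folded A_def B_def C_def]
    have E1: "1 + A s + B s + C s = 0"
      using addition that
      by (simp add: BKP_addition_def Let_def A_def B_def C_def c F12_def F23_def F31_def mult.commute)
    \<comment> \<open>The equation from the square of \<open>\<Theta>\<close>, divided by
      \<open>p1 s * p2 s * p3 s\<close>; this turns the unknowns into reciprocals, as they occur in
      \<open>f\<close>.\<close>
    have E3: "A s * (1 / p2 s + 1 / p3 s) + B s * (1 / p3 s + 1 / p1 s) + C s * (1 / p1 s + 1 / p2 s) = 0"
    proof -
      have "A s * (1 / p2 s + 1 / p3 s) + B s * (1 / p3 s + 1 / p1 s) + C s * (1 / p1 s + 1 / p2 s)
        = (A s * (p1 s * (p2 s + p3 s)) + B s * (p2 s * (p3 s + p1 s)) + C s * (p3 s * (p1 s + p2 s)))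
          / (p1 s * p2 s * p3 s)"
        using that by (simp add: field_simps)
      then show ?thesis using coeffs(2) by simp
    qed
    note sol = cross_product_solution[OF E1 coeffs(1) E3, folded P'_def]
    show "P s = P' s"
      by (simp add: P_def P'_def f algebra_simps)
    show "Q s = - A s * P' s"
      by (subst sol(1)[symmetric]) (simp add: Q_def f algebra_simps)
    show "R s = - B s * P' s"
      by (subst sol(2)[symmetric]) (simp add: R_def f algebra_simps)
    show "S s = - C s * P' s"
      by (subst sol(3)[symmetric]) (simp add: S_def f algebra_simps)
  qed

  have \<phi>_orbit: "p1 \<in> vertex_orbit \<phi>" "p2 \<in> vertex_orbit \<phi>" "p3 \<in> vertex_orbit \<phi>"
    "x \<in> vertex_orbit \<phi>" "y \<in> vertex_orbit \<phi>" "w \<in> vertex_orbit \<phi>"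
    unfolding p x_def y_def w_def by (intro vertex_orbit.intros z_norm)+
  \<comment> \<open>The choice of \<open>z1\<close> is arbitrary: the operator serves only to supply
    differentiability in the coordinates.\<close>
  note lim = \<phi>_orbit[THEN has_vertex_derivative_tendsto[OF
        admissible_on_has_vertex_derivative[OF \<phi> _ z_norm(1) t]]]
  have p_nz: "p1 t \<noteq> 0" "p2 t \<noteq> 0" "p3 t \<noteq> 0"
    using \<phi>_nz by (simp_all add: p)
  have "P' t \<noteq> 0"
    using args_nz(1) PQRS(1)[of t] t p_nz by simp
  moreover have "((\<lambda>x. P' (t(n := x))) \<longlongrightarrow> P' t) (nhds (t n))" for n
    unfolding P'_def by (intro tendsto_intros lim p_nz)
  ultimately have "coord_near t (\<lambda>s. P' s \<noteq> 0)"
    unfolding coord_near_def using tendsto_imp_eventually_ne by blast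
  moreover have "coord_near t (\<lambda>s. p1 s \<noteq> 0)" "coord_near t (\<lambda>s. p2 s \<noteq> 0)" "coord_near t (\<lambda>s. p3 s \<noteq> 0)"
    unfolding coord_near_def using tendsto_imp_eventually_ne lim(1-3) p_nz by blast+
  ultimately have near: "coord_near t (\<lambda>s. ?good s \<and> P' s \<noteq> 0)"
    by (intro coord_near_conj finitely_open_coord_near[OF U t])

  \<comment> \<open>The factors \<open>P' s\<close> cancel, and so do \<open>F12\<close> and
    \<open>F31\<close>, leaving \<open>F23\<close> twice. With \<open>exp_double\<close> the claim
    is rational in the exponentials.\<close>
  have e1: "coord_near t (\<lambda>s. (P s * Q s) / (R s * S s) = - 1 / c1\<^sup>2 * exp (2 * F23 s))"
    by (rule coord_near_mono[OF near])
      (unfold exp_double, use c_nz in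
        \<open>simp add: PQRS A_def B_def C_def exp_add exp_diff exp_minus field_simps power2_eq_square\<close>)
  \<comment> \<open>The same cancellation with \<open>F31\<close> in place of
    \<open>F23\<close>.\<close>
  have e2: "coord_near t (\<lambda>s. (P s * R s) / (S s * Q s) = - 1 / c2\<^sup>2 * exp (2 * F31 s))"
    by (rule coord_near_mono[OF near])
      (unfold exp_double, use c_nz in
        \<open>simp add: PQRS A_def B_def C_def exp_add exp_diff exp_minus field_simps power2_eq_square\<close>)
  have F_orbit: "F23 \<in> vertex_orbit F" "F31 \<in> vertex_orbit F" "vertex_op z3 F \<in> vertex_orbit F"
    "vertex_op z1 (vertex_op z3 F) \<in> vertex_orbit F"
    unfolding F23_def F31_def by (intro vertex_orbit.intros z_norm)+
  note dF = admissible_on_has_vertex_derivative[OF F _ _ t]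
  have "vertex_dln z1 (\<lambda>s. (P s * Q s) / (R s * S s)) t = 2 * vertex_op z1 F23 t"
    using c_nz by (intro vertex_dln_exp[OF dF e1] F_orbit z_norm) simp
  also have "vertex_op z1 F23 t = vertex_op z2 (vertex_op z1 (vertex_op z3 F)) t"
    unfolding F23_def by (rule admissible_on_vertex_op_commute[OF F F_orbit(3) z_norm(1,2) t])
  \<comment> \<open>Commutativity inside the outer operator is known only on \<open>U\<close>, not
    as an equality of functions, so the exchange of \<open>z1\<close> and \<open>z3\<close> goes
    through locality.\<close>
  also have "\<dots> = vertex_op z2 F31 t"
  proof (rule vertex_op_cong_coord_near[OF dF[OF F_orbit(2) z_norm(2)]])
    show "coord_near t (\<lambda>s. F31 s = vertex_op z1 (vertex_op z3 F) s)"
      unfolding F31_def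
      by (rule coord_near_mono[OF finitely_open_coord_near[OF U t]])
        (rule admissible_on_vertex_op_commute[OF F vertex_orbit.base z_norm(3,1)])
  qed
  also have "2 * vertex_op z2 F31 t = vertex_dln z2 (\<lambda>s. (P s * R s) / (S s * Q s)) t"
    using c_nz by (intro vertex_dln_exp[OF dF e2, symmetric] F_orbit z_norm) simp
  finally show ?thesis .
qed

end
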